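(* Let $n,N\ge1$ be integers and let $f$ be a real-valued function on $\hat F_N^n$. For $\mathbf m\in\hat D_N^n$ put $$a_{\mathbf m}=\Big(\frac2N\Big)^n|S_n|\sum_{\mathbf s\in\hat F_N^n}f(\mathbf s)\,\sin^-_{\mathbf m}(\mathbf s).$$ Then for all $\mathbf s\in\hat F_N^n$ $$f(\mathbf s)=\sum_{\mathbf m\in\hat D_N^n}a_{\mathbf m}\,\sin^-_{\mathbf m}(\mathbf s).$$
   Context: $F_N^-=\{\frac1N,\frac2N,\dots,\frac{N-1}N\}$; $\hat F_N^n$ is the set of $\mathbf s=(s_1,\dots,s_n)\in(F_N^-)^n$ with $s_1>s_2>\cdots>s_n$; $\hat D_N^n$ is the set of integer $n$-tuples $\mathbf m=(m_1,\dots,m_n)$ with $N>m_1>m_2>\cdots>m_n>0$. $|S_n|=n!$ is the order of the symmetric group. The discrete functions are $\sin^-_{\mathbf m}(\mathbf s)=|S_n|^{-1/2}\det(\sin\pi m_is_j)_{i,j=1}^n$. *)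

theory Defs
  imports Complex_Main "Jordan_Normal_Form.Determinant"
begin

text \<open>Tuples are vectors of dimension \<open>n\<close> with components indexed from \<open>0\<close> to \<open>n - 1\<close>.\<close>

definition Fminus :: "nat \<Rightarrow> real set" where
  "Fminus N = {real k / real N | k. 1 \<le> k \<and> k < N}"

definition Fhat :: "nat \<Rightarrow> nat \<Rightarrow> real vec set" where
  "Fhat n N = {s \<in> carrier_vec n. (\<forall>i<n. s $ i \<in> Fminus N) \<and>
     (\<forall>i j. i < j \<and> j < n \<longrightarrow> s $ i > s $ j)}"

definition Dhat :: "nat \<Rightarrow> nat \<Rightarrow> int vec set" where
  "Dhat n N = {m \<in> carrier_vec n. (\<forall>i<n. 0 < m $ i \<and> m $ i < int N) \<and>
     (\<forall>i j. i < j \<and> j < n \<longrightarrow> m $ i > m $ j)}"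

definition sin_minus :: "nat \<Rightarrow> int vec \<Rightarrow> real vec \<Rightarrow> real" where
  "sin_minus n m s =
     fact n powr (- 1 / 2) * det (mat n n (\<lambda>(i, j). sin (pi * of_int (m $ i) * s $ j)))"

definition sine_coeff :: "nat \<Rightarrow> nat \<Rightarrow> (real vec \<Rightarrow> real) \<Rightarrow> int vec \<Rightarrow> real" where
  "sine_coeff n N f m = (2 / real N) ^ n * fact n * (\<Sum>s\<in>Fhat n N. f s * sin_minus n m s)"

text \<open>Both index sets are finite, so the sums over them are not degenerate.\<close>

lemma finite_vec_set:
  assumes "finite A"
  shows "finite {v \<in> carrier_vec n. \<forall>i<n. v $ i \<in> A}"
proof (rule finite_subset)
  show "{v \<in> carrier_vec n. \<forall>i<n. v $ i \<in> A} \<subseteq> vec_of_list ` {xs. set xs \<subseteq> A \<and> length xs = n}"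
  proof
    fix v assume v: "v \<in> {v \<in> carrier_vec n. \<forall>i<n. v $ i \<in> A}"
    have "set (list_of_vec v) \<subseteq> A"
      using v by (auto simp: in_set_conv_nth list_of_vec_index)
    moreover have "length (list_of_vec v) = n" using v by auto
    moreover have "v = vec_of_list (list_of_vec v)" by (simp add: vec_list)
    ultimately show "v \<in> vec_of_list ` {xs. set xs \<subseteq> A \<and> length xs = n}" by blast
  qed
  show "finite (vec_of_list ` {xs. set xs \<subseteq> A \<and> length xs = n})"
    using finite_lists_length_eq[OF assms] by auto
qed

lemma finite_Fhat: "finite (Fhat n N)"
proof (rule finite_subset)
  show "Fhat n N \<subseteq> {s \<in> carrier_vec n. \<forall>i<n. s $ i \<in> Fminus N}"
    by (auto simp: Fhat_def)
  have "Fminus N = (\<lambda>k. real k / real N) ` {1..<N}" by (auto simp: Fminus_def)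
  then show "finite {s \<in> carrier_vec n. \<forall>i<n. s $ i \<in> Fminus N}"
    by (intro finite_vec_set) simp
qed

lemma finite_Dhat: "finite (Dhat n N)"
proof (rule finite_subset)
  show "Dhat n N \<subseteq> {m \<in> carrier_vec n. \<forall>i<n. m $ i \<in> {0<..<int N}}"
    by (auto simp: Dhat_def)
qed (intro finite_vec_set, simp)

end

theory Submission
  imports Defs "HOL-Library.FuncSet"
begin

text \<open>Writing out \<open>sine_coeff\<close>, the right-hand side becomes a sum over \<open>t\<close> of \<open>f t\<close> times
  the sum over \<open>m\<close> of the products of the two determinants at \<open>s\<close> and \<open>t\<close>. By the Cauchy--Binet
  formula this inner sum is the determinant of the \<open>n \<times> n\<close> matrix with entries
  \<open>\<Sum>k. sin (\<pi> k s\<^sub>i) sin (\<pi> k t\<^sub>j)\<close>, which one-dimensional discrete orthogonality of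
  sines evaluates to \<open>N/2\<close> if \<open>s\<^sub>i = t\<^sub>j\<close> and to \<open>0\<close> otherwise.\<close>

section \<open>Strictly decreasing tuples and the Cauchy-Binet formula\<close>

lemma decreasing_enumeration_unique:
  fixes a b :: "nat \<Rightarrow> 'b::linorder"
  assumes "\<And>i j. i < j \<Longrightarrow> j < n \<Longrightarrow> a j < a i" and "\<And>i j. i < j \<Longrightarrow> j < n \<Longrightarrow> b j < b i"
    and "a ` {0..<n} = b ` {0..<n}" and "i < n"
  shows "a i = b i"
proof -
  have *: "sorted_wrt (<) (rev (map c [0..<n]))"
    if "\<And>i j. i < j \<Longrightarrow> j < n \<Longrightarrow> c j < c i" for c :: "nat \<Rightarrow> 'b"
    unfolding sorted_wrt_rev sorted_wrt_map using that by (simp add: sorted_wrt_iff_nth_less)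
  \<comment> \<open>Reversed, both enumerations are strictly increasing lists with the same set of
    elements, which determines the list.\<close>
  have "rev (map a [0..<n]) = rev (map b [0..<n])"
    by (rule strict_sorted_equal) (use * assms in auto)
  then show ?thesis using assms(4) by simp
qed

text \<open>Functions rather than vectors, so that the tuples lie in the \<open>PiE\<close> space
  indexing an expanded product of sums; being extensional, they are equal once they agree below
  \<open>n\<close>.\<close>

definition decreasing_tuples :: "nat \<Rightarrow> 'b::linorder set \<Rightarrow> (nat \<Rightarrow> 'b) set" where
  "decreasing_tuples n S = {m \<in> {0..<n} \<rightarrow>\<^sub>E S. \<forall>i j. i < j \<and> j < n \<longrightarrow> m j < m i}"

lemma decreasing_tuples_inj_on:
  assumes "m \<in> decreasing_tuples n S"
  shows "inj_on m {0..<n}"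
proof (rule linorder_inj_onI)
  fix i j assume "i < j" "i \<in> {0..<n}" "j \<in> {0..<n}"
  then have "m j < m i" using assms by (simp add: decreasing_tuples_def)
  then show "m i \<noteq> m j" by simp
qed auto

text \<open>Sorting an injective tuple yields its decreasing rearrangement \<open>m\<close>, and
  \<open>p\<close> records where each entry went. This regroups the expanded determinant in
  \<open>Cauchy_Binet\<close>.\<close>

lemma bij_betw_decreasing_tuples_permutations:
  "bij_betw (\<lambda>(m, p). m \<circ> p) (decreasing_tuples n S \<times> {p. p permutes {0..<n}})
     {g \<in> {0..<n} \<rightarrow>\<^sub>E S. inj_on g {0..<n}}"
  unfolding bij_betw_def
proof
  let ?I = "{0..<n}"
  let ?P = "decreasing_tuples n S \<times> {p. p permutes ?I}"
  show "inj_on (\<lambda>(m, p). m \<circ> p) ?P"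
  proof (rule inj_onI, clarify)
    fix m p m' p'
    assume m: "m \<in> decreasing_tuples n S" "m' \<in> decreasing_tuples n S"
      and p: "p permutes ?I" "p' permutes ?I" and eq: "m \<circ> p = m' \<circ> p'"
    \<comment> \<open>Permuting positions keeps the set of values, and that set alone determines a
      decreasing tuple.\<close>
    have "m ` ?I = m' ` ?I"
      using p by (metis eq image_comp permutes_image)
    then have "m i = m' i" if "i < n" for i
      using decreasing_enumeration_unique[of n m m' i] m that by (auto simp: decreasing_tuples_def)
    then have mm: "m = m'"
      using m by (intro PiE_ext[of _ ?I "\<lambda>_. S"]) (auto simp: decreasing_tuples_def)
    have "p i = p' i" for i
    proof (cases "i < n")
      case True
      then have "p i \<in> ?I" "p' i \<in> ?I" using permutes_in_image p by (metis atLeastLessThan_iff zero_le)+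
      moreover have "m (p i) = m (p' i)" using eq mm by (metis comp_apply)
      ultimately show ?thesis using decreasing_tuples_inj_on[OF m(1)] by (meson inj_onD)
    next
      case False
      then show ?thesis using p by (simp add: permutes_def)
    qed
    then show "m = m' \<and> p = p'" using mm by auto
  qed
  show "(\<lambda>(m, p). m \<circ> p) ` ?P = {g \<in> ?I \<rightarrow>\<^sub>E S. inj_on g ?I}"
  proof (intro equalityI subsetI)
    fix g assume "g \<in> (\<lambda>(m, p). m \<circ> p) ` ?P"
    then obtain m p where m: "m \<in> decreasing_tuples n S" and p: "p permutes ?I" and g: "g = m \<circ> p"
      by auto
    have "inj_on g ?I"
      unfolding g using decreasing_tuples_inj_on[OF m] p
      by (intro comp_inj_on) (auto simp: permutes_image permutes_inj_on)
    moreover have "g \<in> ?I \<rightarrow>\<^sub>E S"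
      using m permutes_in_image[OF p] unfolding g decreasing_tuples_def
      by (auto simp: PiE_iff extensional_def permutes_not_in[OF p])
    ultimately show "g \<in> {g \<in> ?I \<rightarrow>\<^sub>E S. inj_on g ?I}" by simp
  next
    fix g assume "g \<in> {g \<in> ?I \<rightarrow>\<^sub>E S. inj_on g ?I}"
    then have g: "g \<in> ?I \<rightarrow>\<^sub>E S" and inj: "inj_on g ?I" by auto
    \<comment> \<open>The values of \<open>g\<close> in decreasing order supply the witness
      \<open>m\<close>.\<close>
    define l where "l = rev (sorted_list_of_set (g ` ?I))"
    define m where "m = (\<lambda>i\<in>?I. l ! i)"
    have len: "length l = n" by (simp add: l_def card_image[OF inj])
    have setl: "set l = g ` ?I" by (simp add: l_def)
    have dec: "l ! j < l ! i" if "i < j" "j < n" for i j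
    proof -
      have "sorted_wrt (\<lambda>x y. y < x) l"
        unfolding l_def sorted_wrt_rev by simp
      then show ?thesis using that len by (simp add: sorted_wrt_iff_nth_less)
    qed
    have img: "m ` ?I = g ` ?I"
      unfolding setl[symmetric] by (auto simp: m_def set_conv_nth len image_def)
    have m: "m \<in> decreasing_tuples n S"
      unfolding decreasing_tuples_def
    proof (intro CollectI conjI allI impI)
      have "m ` ?I \<subseteq> S" using img g by auto
      then show "m \<in> ?I \<rightarrow>\<^sub>E S" by (auto simp: m_def)
      show "m j < m i" if "i < j \<and> j < n" for i j
        using dec that by (simp add: m_def)
    qed
    have bm: "bij_betw m ?I (g ` ?I)"
      using decreasing_tuples_inj_on[OF m] img by (simp add: bij_betw_def)
    have bg: "bij_betw g ?I (g ` ?I)" using inj by (simp add: bij_betw_def)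
    \<comment> \<open>Each \<open>i\<close> goes to the position of \<open>g i\<close> in the
      decreasing list; \<open>permutes\<close> demands the identity outside the index set.\<close>
    define p where "p = (\<lambda>i. if i \<in> ?I then inv_into ?I m (g i) else i)"
    have "bij_betw (inv_into ?I m \<circ> g) ?I ?I"
      using bg bij_betw_inv_into[OF bm] by (rule bij_betw_trans)
    then have "bij_betw p ?I ?I"
      by (rule bij_betw_cong[THEN iffD1, rotated]) (simp add: p_def)
    then have p: "p permutes ?I" by (intro bij_imp_permutes) (auto simp: p_def)
    have "g i = (m \<circ> p) i" for i
    proof (cases "i \<in> ?I")
      case True
      then show ?thesis using img by (simp add: p_def f_inv_into_f)
    next
      case False
      \<comment> \<open>Here \<open>p\<close> fixes \<open>i\<close>, and \<open>g\<close> and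
        \<open>m\<close> are both \<open>undefined\<close>.\<close>
      then show ?thesis by (simp add: p_def m_def PiE_arb[OF g False])
    qed
    then have "g = m \<circ> p" by auto
    then show "g \<in> (\<lambda>(m, p). m \<circ> p) ` ?P" using m p by force
  qed
qed

text \<open>By multilinearity, choosing one \<open>k\<close> per row gives a sum over tuples
  \<open>g\<close>. Tuples with a repeated entry drop out; the others are grouped by their
  decreasing rearrangement.\<close>

theorem Cauchy_Binet:
  fixes x y :: "'b::linorder \<Rightarrow> nat \<Rightarrow> 'a::comm_ring_1"
  assumes S: "finite S"
  shows "det (mat n n (\<lambda>(i, j). \<Sum>k\<in>S. x k i * y k j)) =
    (\<Sum>m\<in>decreasing_tuples n S.
       det (mat n n (\<lambda>(i, j). x (m i) j)) * det (mat n n (\<lambda>(i, j). y (m i) j)))"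
proof -
  let ?I = "{0..<n}"
  let ?G = "?I \<rightarrow>\<^sub>E S"
  let ?P = "{p. p permutes ?I}"
  let ?d = "\<lambda>g. det (mat n n (\<lambda>(i, j). y (g i) j))"
  have in_I: "p i < n" if "p permutes ?I" "i < n" for p i
    using permutes_in_image[OF that(1), of i] that(2) by simp
  have finG: "finite ?G" using S by (intro finite_PiE) auto
  have "det (mat n n (\<lambda>(i, j). \<Sum>k\<in>S. x k i * y k j)) =
      (\<Sum>p\<in>?P. signof p * (\<Prod>i\<in>?I. \<Sum>k\<in>S. x k i * y k (p i)))"
    by (auto simp: det_def in_I intro!: sum.cong prod.cong)
  also have "\<dots> = (\<Sum>p\<in>?P. \<Sum>g\<in>?G. (\<Prod>i\<in>?I. x (g i) i) * (signof p * (\<Prod>i\<in>?I. y (g i) (p i))))"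
    using S by (simp add: prod_sum_PiE sum_distrib_left prod.distrib mult_ac)
  \<comment> \<open>For fixed \<open>g\<close>, the signed sum over \<open>p\<close> is the Leibniz
    formula for \<open>?d g\<close>.\<close>
  also have "\<dots> = (\<Sum>g\<in>?G. (\<Prod>i\<in>?I. x (g i) i) * ?d g)"
    by (subst sum.swap) (auto simp: det_def in_I sum_distrib_left intro!: sum.cong prod.cong)
  \<comment> \<open>A repeated value of \<open>g\<close> produces two equal rows in
    \<open>?d g\<close>.\<close>
  also have "\<dots> = (\<Sum>g\<in>{g\<in>?G. inj_on g ?I}. (\<Prod>i\<in>?I. x (g i) i) * ?d g)"
  proof (intro sum.mono_neutral_right finG ballI)
    fix g assume "g \<in> ?G - {g\<in>?G. inj_on g ?I}"
    then obtain i j where ij: "i < n" "j < n" "i \<noteq> j" "g i = g j" by (auto simp: inj_on_def)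
    have "?d g = 0"
      by (rule det_identical_rows[OF _ ij(3,1,2)]) (use ij in \<open>auto intro!: eq_vecI\<close>)
    then show "(\<Prod>i\<in>?I. x (g i) i) * ?d g = 0" by simp
  qed auto
  also have "\<dots> = (\<Sum>(m, p)\<in>decreasing_tuples n S \<times> ?P. (\<Prod>i\<in>?I. x (m (p i)) i) * ?d (m \<circ> p))"
    by (subst sum.reindex_bij_betw[OF bij_betw_decreasing_tuples_permutations, symmetric])
       (simp add: case_prod_unfold)
  also have "\<dots> = (\<Sum>m\<in>decreasing_tuples n S. \<Sum>p\<in>?P. (\<Prod>i\<in>?I. x (m (p i)) i) * ?d (m \<circ> p))"
    by (simp add: sum.cartesian_product)
  also have "\<dots> = (\<Sum>m\<in>decreasing_tuples n S. det (mat n n (\<lambda>(i, j). x (m i) j)) * ?d m)"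
  proof (intro sum.cong refl)
    fix m assume "m \<in> decreasing_tuples n S"
    let ?X = "mat n n (\<lambda>(i, j). x (m i) j)"
    \<comment> \<open>Reordering rows costs only a sign, so \<open>?d m\<close> factors out of the
      sum over \<open>p\<close>.\<close>
    have "?d (m \<circ> p) = signof p * ?d m" if "p permutes ?I" for p
    proof -
      have "mat n n (\<lambda>(i, j). y ((m \<circ> p) i) j) =
          mat n n (\<lambda>(i, j). mat n n (\<lambda>(i, j). y (m i) j) $$ (p i, j))"
        by (intro eq_matI) (auto simp: in_I that)
      then show ?thesis using det_permute_rows[OF mat_carrier that, of "\<lambda>(i, j). y (m i) j"] by (simp only:)
    qed
    then have "(\<Sum>p\<in>?P. (\<Prod>i\<in>?I. x (m (p i)) i) * ?d (m \<circ> p)) =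
        (\<Sum>p\<in>?P. signof p * (\<Prod>i\<in>?I. x (m (p i)) i)) * ?d m"
      by (simp add: sum_distrib_left sum_distrib_right mult_ac)
    \<comment> \<open>The factors sit in row \<open>p i\<close> and column \<open>i\<close> of
      \<open>?X\<close>, hence the transpose.\<close>
    also have "(\<Sum>p\<in>?P. signof p * (\<Prod>i\<in>?I. x (m (p i)) i)) = det (transpose_mat ?X)"
      by (auto simp: det_def in_I intro!: sum.cong prod.cong)
    also have "\<dots> = det ?X" by (rule det_transpose[OF mat_carrier])
    finally show "(\<Sum>p\<in>?P. (\<Prod>i\<in>?I. x (m (p i)) i) * ?d (m \<circ> p)) = det ?X * ?d m" .
  qed
  finally show ?thesis .
qed

section \<open>Discrete orthogonality of sines in one variable\<close>

lemma sum_cos_equidistant: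
  fixes c :: int
  assumes "0 < c" "c < 2 * int N"
  shows "(\<Sum>k<N. cos (pi * real k * c / N)) = (1 - cos (pi * c)) / 2"
proof -
  \<comment> \<open>Half the step between consecutive angles: multiplication by
    \<open>2 * sin h\<close> makes the sum telescope. The bounds on \<open>c\<close> put
    \<open>h\<close> strictly between 0 and \<open>pi\<close>, so \<open>sin h\<close> can be
    cancelled.\<close>
  define h where "h = pi * c / (2 * N)"
  have N: "real N > 0" using assms by simp
  have "c < 2 * real N" using assms(2) by linarith
  then have "0 < h" "h < pi" using assms N by (auto simp: h_def field_simps)
  then have sh: "sin h \<noteq> 0" using sin_gt_zero[of h] by linarith
  have "2 * sin h * (\<Sum>k<N. cos (pi * real k * c / N)) =
      (\<Sum>k<N. sin (2 * real (Suc k) * h - h) - sin (2 * real k * h - h))"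
    unfolding sum_distrib_left
  proof (rule sum.cong[OF refl])
    fix k
    have "pi * real k * c / N = 2 * real k * h" using N by (simp add: h_def field_simps)
    moreover have "2 * real (Suc k) * h - h = 2 * real k * h + h" by (simp add: algebra_simps)
    ultimately show "2 * sin h * cos (pi * real k * c / N) =
        sin (2 * real (Suc k) * h - h) - sin (2 * real k * h - h)"
      by (simp add: sin_add sin_diff)
  qed
  also have "\<dots> = sin (2 * real N * h - h) + sin h"
    by (subst sum_lessThan_telescope) simp
  also have "2 * real N * h = pi * c" using N by (simp add: h_def)
  also have "sin (pi * c - h) + sin h = sin h * (1 - cos (pi * c))"
  proof -
    have "sin (pi * c) = 0" by (auto simp: sin_zero_iff_int2)
    then show ?thesis by (simp add: sin_diff right_diff_distrib)
  qed
  finally have "2 * (\<Sum>k<N. cos (pi * real k * c / N)) = 1 - cos (pi * c)"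
    using sh by (metis mult.assoc mult.commute mult_left_cancel)
  then show ?thesis by (metis nonzero_mult_div_cancel_left zero_neq_numeral)
qed

text \<open>The arguments differ by a multiple of \<open>2 * pi\<close>. Hence the closed form of
  the cosine sum is the same at \<open>a - b\<close> and \<open>a + b\<close>.\<close>

lemma cos_pi_diff_eq_add: "cos (pi * of_int (a - b)) = cos (pi * of_int (a + b))"
proof -
  have "sin (pi * of_int b) = 0" by (auto simp: sin_zero_iff_int2)
  then show ?thesis by (simp add: distrib_left right_diff_distrib cos_add cos_diff)
qed

text \<open>Product-to-sum leaves half the difference of the cosine sums at \<open>a - b\<close> and
  \<open>a + b\<close>. For distinct \<open>a\<close> and \<open>b\<close> these cancel; for
  \<open>a = b\<close> the first is \<open>N\<close> and the second is 0.\<close>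

lemma sum_sin_sin_orthogonal:
  assumes a: "0 < a" "a < N" and b: "0 < b" "b < N"
  shows "(\<Sum>k<N. sin (pi * real k * (real a / N)) * sin (pi * real k * (real b / N)))
    = (if a = b then real N / 2 else 0)"
proof -
  let ?C = "\<lambda>c::int. \<Sum>k<N. cos (pi * real k * of_int c / N)"
  have "(\<Sum>k<N. sin (pi * real k * (real a / N)) * sin (pi * real k * (real b / N))) =
      (?C (int a - int b) - ?C (int a + int b)) / 2"
    unfolding sum_subtractf[symmetric] sum_divide_distrib
    by (simp add: sin_times_sin add_divide_distrib diff_divide_distrib distrib_left right_diff_distrib)
  moreover have "?C (int a + int b) = (1 - cos (pi * of_int (int a + int b))) / 2"
    using a b by (intro sum_cos_equidistant) auto
  moreover have "?C (int a - int b) = (1 - cos (pi * of_int (int a + int b))) / 2" if "b < a"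
    unfolding cos_pi_diff_eq_add[symmetric] using a b that by (intro sum_cos_equidistant) auto
  moreover have "?C (int a - int b) = (1 - cos (pi * of_int (int a + int b))) / 2" if "a < b"
  proof -
    \<comment> \<open>Evenness of the cosine makes the frequency positive, as
      \<open>sum_cos_equidistant\<close> requires.\<close>
    have "?C (int a - int b) = ?C (int b - int a)"
    proof (rule sum.cong[OF refl])
      fix k
      have "pi * real k * of_int (int a - int b) / N = - (pi * real k * of_int (int b - int a) / N)"
        by (simp add: minus_divide_left right_diff_distrib)
      then show "cos (pi * real k * of_int (int a - int b) / N) =
          cos (pi * real k * of_int (int b - int a) / N)" by (metis cos_minus)
    qed
    also have "\<dots> = (1 - cos (pi * of_int (int b + int a))) / 2"
      unfolding cos_pi_diff_eq_add[symmetric] using a b that by (intro sum_cos_equidistant) auto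
    finally show ?thesis by (simp add: add.commute)
  qed
  \<comment> \<open>This makes the sum at \<open>a + a\<close> vanish in the diagonal case.\<close>
  moreover have "cos (pi * of_int (int a + int a)) = (1::real)"
    using cos_pi_diff_eq_add[of "int a" "int a"] by simp
  ultimately show ?thesis by (cases a b rule: linorder_cases) auto
qed

lemma sum_sin_sin_Fminus:
  assumes "u \<in> Fminus N" "v \<in> Fminus N"
  shows "(\<Sum>k\<in>{0<..<int N}. sin (pi * of_int k * u) * sin (pi * of_int k * v)) =
    (if u = v then real N / 2 else 0)"
proof -
  obtain a b where ab: "0 < a" "a < N" "0 < b" "b < N" "u = real a / N" "v = real b / N"
    using assms by (auto simp: Fminus_def)
  have "(\<Sum>k\<in>{0<..<int N}. sin (pi * of_int k * u) * sin (pi * of_int k * v)) =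
      (\<Sum>k\<in>{0<..<N}. sin (pi * real k * u) * sin (pi * real k * v))"
    by (rule sum.reindex_bij_witness[of _ int nat]) auto
  \<comment> \<open>The added term \<open>k = 0\<close> is zero.\<close>
  also have "\<dots> = (\<Sum>k<N. sin (pi * real k * u) * sin (pi * real k * v))"
    by (rule sum.mono_neutral_left) auto
  finally show ?thesis using sum_sin_sin_orthogonal[OF ab(1-4)] ab by simp
qed

section \<open>Orthogonality of the determinants and inversion of the transform\<close>

lemma sum_Dhat_sin_minus_orthogonal:
  assumes s: "s \<in> Fhat n N" and t: "t \<in> Fhat n N"
  shows "(\<Sum>m\<in>Dhat n N. sin_minus n m s * sin_minus n m t) =
    (if s = t then (real N / 2) ^ n / fact n else 0)"
proof -
  let ?I = "{0..<n}"
  let ?S = "\<lambda>m s. mat n n (\<lambda>(i, j). sin (pi * of_int (m i) * (s::real vec) $ j))"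
  let ?G = "mat n n (\<lambda>(i, j). if s $ i = t $ j then real N / 2 else 0)"
  have F: "s $ i \<in> Fminus N" "t $ i \<in> Fminus N" if "i < n" for i
    using s t that by (auto simp: Fhat_def)
  have fact2: "fact n powr (- 1 / 2) * fact n powr (- 1 / 2) = 1 / (fact n :: real)"
    by (simp add: powr_add[symmetric] powr_minus_divide)
  have "(\<Sum>m\<in>Dhat n N. sin_minus n m s * sin_minus n m t) =
      (\<Sum>m\<in>Dhat n N. det (?S (($) m) s) * det (?S (($) m) t)) / fact n"
    unfolding sum_divide_distrib
  proof (intro sum.cong refl)
    fix m
    have "sin_minus n m s * sin_minus n m t =
        (fact n powr (- 1 / 2) * fact n powr (- 1 / 2)) * (det (?S (($) m) s) * det (?S (($) m) t))"
      by (simp only: sin_minus_def mult_ac)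
    then show "sin_minus n m s * sin_minus n m t =
        det (?S (($) m) s) * det (?S (($) m) t) / fact n"
      by (simp only: fact2) simp
  qed
  also have "(\<Sum>m\<in>Dhat n N. det (?S (($) m) s) * det (?S (($) m) t)) =
      (\<Sum>m\<in>decreasing_tuples n {0<..<int N}. det (?S m s) * det (?S m t))"
  \<comment> \<open>Restriction replaces the unspecified values of \<open>($) m\<close> beyond the
    dimension by \<open>undefined\<close>, so vectors and extensional functions correspond.\<close>
  proof (rule sum.reindex_bij_witness[of _ "vec n" "\<lambda>m. restrict (($) m) ?I"])
    fix m assume "m \<in> Dhat n N"
    then show "vec n (restrict (($) m) ?I) = m"
      by (intro eq_vecI) (auto simp: Dhat_def)
    show "restrict (($) m) ?I \<in> decreasing_tuples n {0<..<int N}"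
      using \<open>m \<in> Dhat n N\<close> by (auto simp: Dhat_def decreasing_tuples_def)
    have "?S (restrict (($) m) ?I) s = ?S (($) m) s" for s by (intro eq_matI) auto
    then show "det (?S (restrict (($) m) ?I) s) * det (?S (restrict (($) m) ?I) t) =
        det (?S (($) m) s) * det (?S (($) m) t)" by simp
  next
    fix m assume m: "m \<in> decreasing_tuples n {0<..<int N}"
    then have "m \<in> extensional ?I" by (simp add: decreasing_tuples_def PiE_iff)
    then show "restrict (($) (vec n m)) ?I = m"
      by (intro ext) (simp add: restrict_def extensional_def)
    show "vec n m \<in> Dhat n N"
      using m by (auto simp: Dhat_def decreasing_tuples_def PiE_iff)
  qed
  also have "\<dots> = det (mat n n (\<lambda>(i, j).
      \<Sum>k\<in>{0<..<int N}. sin (pi * of_int k * s $ i) * sin (pi * of_int k * t $ j)))"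
    by (rule Cauchy_Binet[symmetric]) simp
  also have "\<dots> = det ?G"
    by (intro arg_cong[of _ _ det] eq_matI) (auto simp: sum_sin_sin_Fminus F)
  also have "det ?G = (if s = t then (real N / 2) ^ n else 0)"
  proof (cases "s = t")
    case True
    \<comment> \<open>Entries of \<open>s\<close> are distinct, so \<open>?G\<close> is zero off the
      diagonal.\<close>
    have "s $ i \<noteq> s $ j" if "i < n" "j < n" "i \<noteq> j" for i j
      using s that by (cases i j rule: linorder_cases) (force simp: Fhat_def)+
    then have "?G = (real N / 2) \<cdot>\<^sub>m 1\<^sub>m n"
      using True by (intro eq_matI) auto
    then show ?thesis using True by simp
  next
    case False
    \<comment> \<open>A nonzero Leibniz product would match every \<open>s $ i\<close> with
      \<open>t $ p i\<close>; then \<open>s\<close> and \<open>t\<close> have the same values and,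
      both being decreasing, coincide.\<close>
    have "(\<Prod>i\<in>?I. ?G $$ (i, p i)) = 0" if p: "p permutes ?I" for p
    proof (rule ccontr)
      assume nz: "(\<Prod>i\<in>?I. ?G $$ (i, p i)) \<noteq> 0"
      have "s $ i = t $ p i" if "i \<in> ?I" for i
      proof -
        have "?G $$ (i, p i) \<noteq> 0"
        proof
          assume "?G $$ (i, p i) = 0"
          with that have "(\<Prod>i\<in>?I. ?G $$ (i, p i)) = 0" by (intro prod_zero) auto
          with nz show False by contradiction
        qed
        then show ?thesis using that permutes_in_image[OF p, of i] by (auto split: if_splits)
      qed
      then have "($) s ` ?I = ($) t ` (p ` ?I)" by (auto simp: image_image)
      then have "($) s ` ?I = ($) t ` ?I" by (simp add: permutes_image[OF p])
      then have "s $ i = t $ i" if "i < n" for i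
        using decreasing_enumeration_unique[of n "($) s" "($) t" i] s t that
        by (auto simp: Fhat_def)
      then have "s = t" using s t by (intro eq_vecI) (auto simp: Fhat_def)
      then show False using False by simp
    qed
    then have "det ?G = 0" unfolding det_def by (auto intro!: sum.neutral)
    then show ?thesis using False by simp
  qed
  finally show ?thesis by simp
qed

theorem mainTheorem15:
  fixes n N :: nat and f :: "real vec \<Rightarrow> real"
  assumes "n \<ge> 1" and "N \<ge> 1"
  shows "\<forall>s \<in> Fhat n N. f s = (\<Sum>m\<in>Dhat n N. sine_coeff n N f m * sin_minus n m s)"
proof
  fix s assume s: "s \<in> Fhat n N"
  let ?c = "(2 / real N) ^ n * fact n"
  have "(\<Sum>m\<in>Dhat n N. sine_coeff n N f m * sin_minus n m s) =
      (\<Sum>m\<in>Dhat n N. \<Sum>t\<in>Fhat n N. ?c * f t * (sin_minus n m s * sin_minus n m t))"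
    by (simp add: sine_coeff_def sum_distrib_left sum_distrib_right mult_ac)
  \<comment> \<open>After the swap, orthogonality over \<open>m\<close> leaves only the term
    \<open>t = s\<close>.\<close>
  also have "\<dots> = (\<Sum>t\<in>Fhat n N. ?c * f t * (\<Sum>m\<in>Dhat n N. sin_minus n m s * sin_minus n m t))"
    by (subst sum.swap) (simp add: sum_distrib_left)
  also have "\<dots> = (\<Sum>t\<in>Fhat n N. if s = t then ?c * f t * ((real N / 2) ^ n / fact n) else 0)"
    by (intro sum.cong refl) (simp add: sum_Dhat_sin_minus_orthogonal[OF s])
  also have "\<dots> = ?c * f s * ((real N / 2) ^ n / fact n)"
    using s by (simp add: finite_Fhat)
  \<comment> \<open>The weight \<open>?c\<close> is the reciprocal of the orthogonality constant,
    since \<open>N\<close> is nonzero.\<close>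
  also have "\<dots> = f s"
    using assms by (simp add: power_divide)
  finally show "f s = (\<Sum>m\<in>Dhat n N. sine_coeff n N f m * sin_minus n m s)" by simp
qed

end
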